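(* Let $\delta>0$. Suppose that in the quantum winning strategy for the Mermin-GHZ game Alice (player 1) performs the Hadamard transformation $H$ imperfectly with random error with bound $\delta$ (i.e. she applies $H_\epsilon$ in place of $H$, where $\epsilon$ is uniformly distributed on $[-\delta,\delta]$), all other steps being performed correctly. Then for any inputs $x_1,x_2,x_3\in\{0,1\}$ satisfying the promise $x_1\oplus x_2\oplus x_3=0$, the strategy gives a correct answer with probability $$P_{\delta}(x_1,x_2,x_3)=\frac{1}{2\delta}\left(\delta+\sin^{2}\left(\frac{\pi}{4}+\frac{\delta}{2}\right)-\sin^{2}\left(\frac{\pi}{4}-\frac{\delta}{2}\right)\right).$$ Moreover, for a question $(x_1,x_2,x_3)$ chosen uniformly at random from the promise set $P$, it gives a correct answer with probability $$P_{\delta}=\frac{1}{2\delta}\left(\delta+\sin^{2}\left(\frac{\pi}{4}+\frac{\delta}{2}\right)-\sin^{2}\left(\frac{\pi}{4}-\frac{\delta}{2}\right)\right).$$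
   Context: Mermin-GHZ game: three players, Alice, Bob and Charles (players 1, 2, 3), receive input bits $x_1,x_2,x_3\in\{0,1\}$ respectively, with the promise that $(x_1,x_2,x_3)\in P=\{(x_1,x_2,x_3)\in\{0,1\}^3 : x_1\oplus x_2\oplus x_3=0\}$. Without communicating, they output bits $a_1,a_2,a_3$ respectively. The answer is correct if $a_1\oplus a_2\oplus a_3=x_1\lor x_2\lor x_3$. Quantum winning strategy: the players share the three-qubit state $|\varphi\rangle=\frac{1}{\sqrt2}(|000\rangle+|111\rangle)$, player $i$ holding the $i$-th qubit. On input $x_i$, player $i$ (1) applies to his or her qubit the unitary $U$ given by $U|0\rangle=|0\rangle$, $U|1\rangle=e^{\pi \imath x_i/2}|1\rangle$; (2) applies the Hadamard transformation $H=\frac{1}{\sqrt2}\begin{pmatrix}1&1\\1&-1\end{pmatrix}$; (3) measures the qubit in the computational basis and outputs the measured bit $a_i$. Here $\imath$ is the imaginary unit. Random error with bound $\delta$ in Alice's Hadamard transformation: $\epsilon$ is chosen uniformly at random from $[-\delta,\delta]$, and Alice applies, in step (2), instead of $H$ the unitary $$H_\epsilon=\begin{pmatrix}\cos(\frac{\pi}{4}+\frac{\epsilon}{2}) & \sin(\frac{\pi}{4}+\frac{\epsilon}{2})\\ \sin(\frac{\pi}{4}+\frac{\epsilon}{2}) & -\cos(\frac{\pi}{4}+\frac{\epsilon}{2})\end{pmatrix}$$ (matrix in the computational basis $|0\rangle,|1\rangle$); everything else is unchanged. The probability of a correct answer is taken over both the choice of $\epsilon$ and the measurement outcomes (and, for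 $P_\delta$, over the uniformly random question, chosen independently of $\epsilon$). *)

theory Defs
  imports "HOL-Probability.Probability"
begin

text \<open>
  Bits are booleans (0 is \<^term>\<open>False\<close>, 1 is \<^term>\<open>True\<close>); on them, exclusive or is
  inequality. The triples \<open>(b\<^sub>1, b\<^sub>2, b\<^sub>3)\<close> list the bits of Alice, Bob and Charles
  in this order.
\<close>

type_synonym triple = "bool \<times> bool \<times> bool"

abbreviation bxor :: "bool \<Rightarrow> bool \<Rightarrow> bool"  (infixl "[+]" 65)
  where "a [+] b \<equiv> a \<noteq> b"

definition promise :: "triple set"
  where "promise = {(x1, x2, x3). (x1 [+] x2 [+] x3) = False}"

fun correct :: "triple \<Rightarrow> triple \<Rightarrow> bool"
  where "correct (x1, x2, x3) (a1, a2, a3) \<longleftrightarrow> (a1 [+] a2 [+] a3) = (x1 \<or> x2 \<or> x3)"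

text \<open>
  One-qubit operators are matrices in the computational basis indexed by \<^typ>\<open>bool\<close>
  (\<open>A $ i $ j\<close> is the entry in row \<open>i\<close>, column \<open>j\<close>), and three-qubit states are vectors
  indexed by the computational basis of \<open>\<complex>\<^sup>2 \<otimes> \<complex>\<^sup>2 \<otimes> \<complex>\<^sup>2\<close>.
\<close>

type_synonym gate = "complex ^ bool ^ bool"
type_synonym state = "complex ^ triple"

definition mat2 :: "complex \<Rightarrow> complex \<Rightarrow> complex \<Rightarrow> complex \<Rightarrow> gate"
  where "mat2 a b c d = (\<chi> i j. if i then (if j then d else c) else (if j then b else a))"

definition tensor3 :: "gate \<Rightarrow> gate \<Rightarrow> gate \<Rightarrow> complex ^ triple ^ triple"
  where "tensor3 A B C =
    (\<chi> i j. case i of (i1, i2, i3) \<Rightarrow> case j of (j1, j2, j3) \<Rightarrow>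
       A $ i1 $ j1 * B $ i2 $ j2 * C $ i3 $ j3)"

definition ghz :: state
  where "ghz = (1 / sqrt 2) *\<^sub>R (axis (False, False, False) 1 + axis (True, True, True) 1)"

definition phase_gate :: "bool \<Rightarrow> gate"
  where "phase_gate x = mat2 1 0 0 (exp (of_real pi * \<i> * of_bool x / 2))"

definition hadamard :: gate
  where "hadamard = (1 / sqrt 2) *\<^sub>R mat2 1 1 1 (- 1)"

definition noisy_hadamard :: "real \<Rightarrow> gate"
  where "noisy_hadamard \<epsilon> =
    mat2 (of_real (cos (pi / 4 + \<epsilon> / 2))) (of_real (sin (pi / 4 + \<epsilon> / 2)))
         (of_real (sin (pi / 4 + \<epsilon> / 2))) (of_real (- cos (pi / 4 + \<epsilon> / 2)))"

text \<open>The joint state before the measurement, when Alice applies \<open>A\<close> in the Hadamard step.\<close>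

fun final_state :: "gate \<Rightarrow> triple \<Rightarrow> state"
  where "final_state A (x1, x2, x3) =
    tensor3 A hadamard hadamard *v
      (tensor3 (phase_gate x1) (phase_gate x2) (phase_gate x3) *v ghz)"

text \<open>Born rule for the computational basis; meaningful for unit vectors \<open>\<psi>\<close> only.\<close>

definition measurement :: "state \<Rightarrow> triple pmf"
  where "measurement \<psi> = embed_pmf (\<lambda>a. (cmod (\<psi> $ a))\<^sup>2)"

definition answers :: "real \<Rightarrow> triple \<Rightarrow> triple pmf"
  where "answers \<epsilon> x = measurement (final_state (noisy_hadamard \<epsilon>) x)"

lemma sum_triple: "(\<Sum>t\<in>(UNIV::triple set). f t) =
   f (False,False,False) + f (False,False,True) + f (False,True,False) + f (False,True,True)
 + f (True,False,False) + f (True,False,True) + f (True,True,False) + (f (True,True,True) :: 'a::comm_monoid_add)"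
proof -
  have U: "(UNIV::triple set) = {(False,False,False),(False,False,True),(False,True,False),(False,True,True),(True,False,False),(True,False,True),(True,True,False),(True,True,True)}" by auto
  show ?thesis unfolding U by (simp add: ac_simps)
qed

lemma of_real_sqrt2_mult: "complex_of_real (sqrt 2) * complex_of_real (sqrt 2) = 2"
  by (metis of_real_mult real_sqrt_mult_self abs_numeral of_real_numeral)

lemma final_state_nth:
  "final_state A (x1,x2,x3) $ (a1,a2,a3) =
    (1 / (2 * sqrt 2)) *\<^sub>R (A $ a1 $ False + (-1) ^ (of_bool a2 + of_bool a3) *
      exp (of_real pi * \<i> * (of_bool x1 + of_bool x2 + of_bool x3) / 2) * A $ a1 $ True)"
proof -
  have e: "exp (of_real pi * \<i> * (of_bool x1 + of_bool x2 + of_bool x3) / 2)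
     = exp (of_real pi * \<i> * of_bool x1 / 2) * exp (of_real pi * \<i> * of_bool x2 / 2) * exp (of_real pi * \<i> * of_bool x3 / 2)"
    by (simp add: exp_add [symmetric] algebra_simps add_divide_distrib)
  show ?thesis unfolding e
    apply (cases a2; cases a3;
     simp add: matrix_vector_mult_def sum_triple tensor3_def ghz_def phase_gate_def hadamard_def mat2_def axis_def)
    by (simp_all add: scaleR_conv_of_real field_simps of_real_sqrt2_mult)
qed

lemma cmod_exp_phase: "cmod (exp (of_real pi * \<i> * (of_bool x1 + of_bool x2 + of_bool x3) / 2)) = 1"
  by (auto simp: norm_exp_eq_Re of_bool_def)

lemma cmod_parallelogram: "cmod (of_real c + z * of_real s)^2 + cmod (of_real c - z * of_real s)^2 = 2 * (c^2 + (cmod z)^2 * s^2)"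
  unfolding cmod_power2 by (simp add: power2_eq_square algebra_simps)

lemma final_state_unit: "(\<Sum>a\<in>UNIV. (cmod (final_state (noisy_hadamard e) x $ a))^2) = 1"
proof -
  obtain x1 x2 x3 where x: "x = (x1,x2,x3)" by (cases x)
  define z where "z = exp (of_real pi * \<i> * (of_bool x1 + of_bool x2 + of_bool x3) / (2::complex))"
  have z: "cmod z = 1" unfolding z_def by (rule cmod_exp_phase)
  let ?c = "cos (pi/4+e/2)" let ?s = "sin (pi/4+e/2)"
  have p1: "cmod (of_real ?c - z * of_real ?s)^2 = 2 * (?c^2 + ?s^2) - cmod (of_real ?c + z * of_real ?s)^2" using cmod_parallelogram[of ?c z ?s] z by simp
  have p2: "cmod (of_real ?s - z * of_real ?c)^2 = 2 * (?c^2 + ?s^2) - cmod (of_real ?s + z * of_real ?c)^2" using cmod_parallelogram[of ?s z ?c] z by simp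
  show ?thesis unfolding x sum_triple final_state_nth z_def[symmetric]
    by (simp add: noisy_hadamard_def mat2_def power_mult_distrib p1 p2 power_divide) (simp add: field_simps)
qed

text \<open>The state is a unit vector, so \<^const>\<open>embed_pmf\<close> does yield the Born probabilities.\<close>

lemma pmf_answers: "pmf (answers e x) a = (cmod (final_state (noisy_hadamard e) x $ a))^2"
  unfolding answers_def measurement_def
proof (rule pmf_embed_pmf)
  show "(\<integral>\<^sup>+ a. ennreal ((cmod (final_state (noisy_hadamard e) x $ a))\<^sup>2) \<partial>count_space UNIV) = 1"
    by (simp add: nn_integral_count_space_finite final_state_unit)
qed simp

definition random_error :: "real \<Rightarrow> real measure"
  where "random_error \<delta> = uniform_measure lborel {- \<delta>..\<delta>}"

text \<open>Distribution of the answers on question \<open>x\<close>, over the error and the measurement.\<close>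

definition noisy_answers :: "real \<Rightarrow> triple \<Rightarrow> triple measure"
  where "noisy_answers \<delta> x = random_error \<delta> \<bind> (\<lambda>\<epsilon>. measure_pmf (answers \<epsilon> x))"

text \<open>
  Joint distribution of question and answers for a uniformly random question; the product
  measure makes the question independent of the error.
\<close>

definition noisy_game :: "real \<Rightarrow> (triple \<times> triple) measure"
  where "noisy_game \<delta> =
    (measure_pmf (pmf_of_set promise) \<Otimes>\<^sub>M random_error \<delta>) \<bind>
      (\<lambda>(x, \<epsilon>). measure_pmf (map_pmf (Pair x) (answers \<epsilon> x)))"

definition success_prob :: "real \<Rightarrow> triple \<Rightarrow> real"
  where "success_prob \<delta> x = measure (noisy_answers \<delta> x) {a. correct x a}"

definition average_success_prob :: "real \<Rightarrow> real"
  where "average_success_prob \<delta> = measure (noisy_game \<delta>) {(x, a). correct x a}"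

end

theory Submission
  imports Defs
begin

text \<open>
  For promised inputs the relative phase of the two branches of the GHZ state is 1 or -1, and
  Alice's amplitudes for the correct answers have modulus proportional to the sum of the cosine
  and the sine of the perturbed angle. A fixed error \<open>\<epsilon>\<close> thus succeeds with probability
  \<open>(1 + cos \<epsilon>) / 2\<close> on every promised question, and it remains to average over \<open>\<epsilon>\<close>.
\<close>

text \<open>Expanding the square leaves 1 plus the sine of the doubled angle, which is a quarter
  turn plus \<open>\<epsilon>\<close>.\<close>

lemma cos_plus_sin_pi4_square: "(cos (pi / 4 + \<epsilon> / 2) + sin (pi / 4 + \<epsilon> / 2))\<^sup>2 = 1 + cos (\<epsilon>::real)"
proof -
  have "sin (2 * (pi / 4 + \<epsilon> / 2)) = cos \<epsilon>"
    by (simp add: distrib_left sin_add)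
  then show ?thesis
    unfolding sin_double by (simp add: power2_sum mult_ac)
qed

text \<open>Links the closed form of the claim to the integral of \<open>cos\<close>: by the
  addition formulas only the cross terms survive, and they combine to the double angle formula at
  \<open>\<delta> / 2\<close>.\<close>

lemma sin_square_pi4_diff: "(sin (pi / 4 + \<delta> / 2))\<^sup>2 - (sin (pi / 4 - \<delta> / 2))\<^sup>2 = sin (\<delta>::real)"
  using sin_double[of "\<delta> / 2"]
  by (simp add: sin_add sin_diff power2_eq_square algebra_simps sin_45 cos_45)

text \<open>Under the promise zero or two inputs are 1, so the phases multiply to a sign that
  encodes the disjunction of the inputs. Correctness turns this sign times the sign from Bob's and
  Charles's outputs into the sign of \<open>a1\<close>, for any gate \<open>A\<close>.\<close>

lemma final_state_correct:
  assumes "(x1, x2, x3) \<in> promise" "correct (x1, x2, x3) (a1, a2, a3)"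
  shows "final_state A (x1, x2, x3) $ (a1, a2, a3)
    = (1 / (2 * sqrt 2)) *\<^sub>R (A $ a1 $ False + (if a1 then - 1 else 1) * A $ a1 $ True)"
proof -
  have "exp (of_real pi * \<i> * (of_bool x1 + of_bool x2 + of_bool x3) / 2)
      = (if x1 \<or> x2 \<or> x3 then - 1 else 1 :: complex)"
    using assms(1) by (cases x1; cases x2; cases x3) (simp_all add: promise_def)
  moreover have "(-1) ^ (of_bool a2 + of_bool a3) * (if x1 \<or> x2 \<or> x3 then - 1 else 1)
      = (if a1 then - 1 else 1 :: complex)"
    using assms(2) by (cases a1; cases a2; cases a3) (simp_all split: if_splits)
  ultimately show ?thesis
    by (simp only: final_state_nth)
qed

lemma pmf_answers_correct:
  assumes "x \<in> promise" "correct x a"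
  shows "pmf (answers \<epsilon> x) a = (1 + cos \<epsilon>) / 8"
proof -
  obtain x1 x2 x3 a1 a2 a3 where xa: "x = (x1, x2, x3)" "a = (a1, a2, a3)"
    by (metis prod_cases3)
  let ?c = "cos (pi / 4 + \<epsilon> / 2)" and ?s = "sin (pi / 4 + \<epsilon> / 2)"
  \<comment> \<open>Both rows of the gate agree here: the sign for \<open>a1\<close> cancels the
    minus in front of the cosine in the second row.\<close>
  have "final_state (noisy_hadamard \<epsilon>) x $ a = of_real ((1 / (2 * sqrt 2)) * (?c + ?s))"
    using assms unfolding xa
    by (subst final_state_correct) (auto simp: noisy_hadamard_def mat2_def scaleR_conv_of_real)
  then have "pmf (answers \<epsilon> x) a = ((1 / (2 * sqrt 2)) * (?c + ?s))\<^sup>2"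
    by (simp only: pmf_answers norm_of_real power2_abs)
  also have "\<dots> = (?c + ?s)\<^sup>2 / 8"
    by (simp add: power_mult_distrib power_divide)
  finally show ?thesis
    by (simp only: cos_plus_sin_pi4_square)
qed

text \<open>Correctness fixes the parity of the answer, which selects half of the eight
  triples.\<close>

lemma card_correct: "card {a. correct x a} = 4"
proof -
  obtain x1 x2 x3 where x: "x = (x1, x2, x3)"
    by (metis prod_cases3)
  have "card {a. correct x a} = (\<Sum>a\<in>UNIV. of_bool (correct x a))"
    by (simp add: of_bool_def sum.If_cases)
  then show ?thesis
    unfolding x sum_triple by (cases "x1 \<or> x2 \<or> x3") simp_all
qed

lemma measure_answers_correct:
  assumes "x \<in> promise"
  shows "measure (answers \<epsilon> x) {a. correct x a} = (1 + cos \<epsilon>) / 2"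
  using assms by (simp add: measure_measure_pmf_finite pmf_answers_correct card_correct)

lemma sets_random_error [measurable_cong, simp]: "sets (random_error \<delta>) = sets borel"
  by (simp add: random_error_def)

lemma prob_space_random_error: "\<delta> > 0 \<Longrightarrow> prob_space (random_error \<delta>)"
  unfolding random_error_def by (rule prob_space_uniform_measure) auto

text \<open>Over a finite type every event is a finite sum of point masses, so a kernel is
  measurable once its point probabilities are.\<close>

lemma measurable_measure_pmf_finite:
  fixes p :: "'a \<Rightarrow> 'b::finite pmf"
  assumes "\<And>y. (\<lambda>x. pmf (p x) y) \<in> borel_measurable M"
  shows "(\<lambda>x. measure_pmf (p x)) \<in> measurable M (subprob_algebra (count_space UNIV))"
proof (rule measurable_subprob_algebra)
  fix A :: "'b set"
  have "(\<lambda>x. emeasure (p x) A) = (\<lambda>x. ennreal (\<Sum>y\<in>A. pmf (p x) y))"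
    by (simp add: measure_pmf.emeasure_eq_measure measure_measure_pmf_finite)
  then show "(\<lambda>x. emeasure (p x) A) \<in> borel_measurable M"
    using assms by simp
qed (auto simp: measure_pmf.subprob_space_axioms)

lemma borel_measurable_pmf_answers [measurable]:
  "(\<lambda>\<epsilon>. pmf (answers \<epsilon> x) a) \<in> borel_measurable borel"
proof -
  obtain x1 x2 x3 a1 a2 a3 where "x = (x1, x2, x3)" "a = (a1, a2, a3)"
    by (metis prod_cases3)
  then show ?thesis
    unfolding pmf_answers
    \<comment> \<open>The case split selects the row of Alice's gate; \<open>final_state\<close>
      stays folded so that \<open>final_state_nth\<close> can rewrite it.\<close>
    by (cases a1; simp add: final_state_nth noisy_hadamard_def mat2_def del: final_state.simps)
qed

lemma pmf_map_Pair: "pmf (map_pmf (Pair x) p) (x', y) = (if x' = x then pmf p y else 0)"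
proof (cases "x' = x")
  case True
  then show ?thesis by (simp add: pmf_map_inj' inj_on_def)
next
  case False
  then show ?thesis by (auto simp: pmf_eq_0_set_pmf)
qed

lemma measurable_answers:
  "(\<lambda>\<epsilon>. measure_pmf (answers \<epsilon> x)) \<in> measurable borel (subprob_algebra (count_space UNIV))"
  by (rule measurable_measure_pmf_finite) measurable

lemma measurable_question_answers:
  "(\<lambda>\<epsilon>. measure_pmf (map_pmf (Pair x) (answers \<epsilon> x)))
     \<in> measurable borel (subprob_algebra (count_space UNIV))"
proof (rule measurable_measure_pmf_finite)
  fix y :: "triple \<times> triple"
  show "(\<lambda>\<epsilon>. pmf (map_pmf (Pair x) (answers \<epsilon> x)) y) \<in> borel_measurable borel"
    by (cases y) (simp add: pmf_map_Pair)
qed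

text \<open>Used to pass between \<open>ennreal\<close> and \<open>real\<close> values of the
  averaged probability.\<close>

lemma add_sin_nonneg: "0 \<le> x \<Longrightarrow> 0 \<le> x + sin (x::real)"
  using sin_x_ge_neg_x[of x] by linarith

lemma nn_integral_random_error:
  assumes "\<delta> > 0"
  shows "(\<integral>\<^sup>+\<epsilon>. ennreal ((1 + cos \<epsilon>) / 2) \<partial>random_error \<delta>) = ennreal (1 / (2 * \<delta>) * (\<delta> + sin \<delta>))"
proof -
  have nonneg: "0 \<le> 1 + cos t" for t :: real
    using cos_ge_minus_one[of t] by linarith
  \<comment> \<open>The antiderivative is \<open>(t + sin t) / 2\<close>; the normalisation by the
    interval length \<open>2 * \<delta>\<close> comes at the end.\<close>
  have "(\<integral>\<^sup>+\<epsilon>. ennreal ((1 + cos \<epsilon>) / 2) * indicator {-\<delta>..\<delta>} \<epsilon> \<partial>lborel)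
      = ennreal ((\<delta> + sin \<delta>) / 2 - (- \<delta> + sin (- \<delta>)) / 2)"
    using assms nonneg
    by (intro nn_integral_FTC_Icc) (auto intro!: derivative_eq_intros)
  moreover have "0 \<le> \<delta> + sin \<delta>"
    using assms by (simp add: add_sin_nonneg)
  ultimately show ?thesis
    using assms unfolding random_error_def
    by (subst nn_integral_uniform_measure) (auto simp: divide_ennreal field_simps)
qed

lemma nn_integral_success:
  assumes "\<delta> > 0" "x \<in> promise"
  shows "(\<integral>\<^sup>+\<epsilon>. emeasure (answers \<epsilon> x) {a. correct x a} \<partial>random_error \<delta>)
    = ennreal (1 / (2 * \<delta>) * (\<delta> + sin \<delta>))"
  using assms
  by (simp add: measure_pmf.emeasure_eq_measure measure_answers_correct nn_integral_random_error
    del: times_divide_eq_left)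

lemma success_prob_promise:
  assumes "\<delta> > 0" "x \<in> promise"
  shows "success_prob \<delta> x = 1 / (2 * \<delta>) * (\<delta> + sin \<delta>)"
proof -
  have "emeasure (noisy_answers \<delta> x) {a. correct x a} = ennreal (1 / (2 * \<delta>) * (\<delta> + sin \<delta>))"
    unfolding noisy_answers_def nn_integral_success[OF assms, symmetric]
    using measurable_answers[of x]
    by (intro emeasure_bind[where N = "count_space UNIV"])
      (auto simp: random_error_def cong: measurable_cong_sets)
  moreover have "0 \<le> \<delta> + sin \<delta>"
    using assms by (simp add: add_sin_nonneg)
  ultimately show ?thesis
    using assms by (simp add: success_prob_def measure_def)
qed

lemma average_success_prob_eq:
  assumes "\<delta> > 0"
  shows "average_success_prob \<delta> = 1 / (2 * \<delta>) * (\<delta> + sin \<delta>)"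
proof -
  let ?Q = "pmf_of_set promise" and ?R = "random_error \<delta>"
  let ?K = "\<lambda>(x, \<epsilon>). measure_pmf (map_pmf (Pair x) (answers \<epsilon> x))"
  let ?S = "{(x, a). correct x a}"
  interpret R: prob_space ?R
    using assms by (rule prob_space_random_error)
  \<comment> \<open>Nonemptiness is what makes the support of \<open>pmf_of_set promise\<close>
    equal to \<open>promise\<close>.\<close>
  have "(False, False, False) \<in> promise"
    by (simp add: promise_def)
  then have Q: "set_pmf ?Q = promise"
    by (intro set_pmf_of_set) auto
  have K: "?K \<in> measurable (measure_pmf ?Q \<Otimes>\<^sub>M ?R) (subprob_algebra (count_space UNIV))"
  proof -
    \<comment> \<open>There are countably many questions, so joint measurability reduces to
      measurability in the error for each fixed question.\<close>
    have "?K \<in> measurable (count_space UNIV \<Otimes>\<^sub>M ?R) (subprob_algebra (count_space UNIV))"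
      using measurable_question_answers
      by (intro measurable_pair_measure_countable1) (auto cong: measurable_cong_sets)
    then show ?thesis
      by (simp cong: measurable_cong_sets sets_pair_measure_cong)
  qed
  have "emeasure (noisy_game \<delta>) ?S = (\<integral>\<^sup>+z. emeasure (?K z) ?S \<partial>(measure_pmf ?Q \<Otimes>\<^sub>M ?R))"
    unfolding noisy_game_def
    using K by (intro emeasure_bind[where N = "count_space UNIV"])
      (auto simp: space_pair_measure R.not_empty)
  \<comment> \<open>Tonelli: the error is integrated out first, with the question held
    fixed.\<close>
  also have "\<dots> = (\<integral>\<^sup>+x. \<integral>\<^sup>+\<epsilon>. emeasure (?K (x, \<epsilon>)) ?S \<partial>?R \<partial>measure_pmf ?Q)"
  proof (rule R.nn_integral_fst[symmetric])
    show "(\<lambda>z. emeasure (?K z) ?S) \<in> borel_measurable (measure_pmf ?Q \<Otimes>\<^sub>M ?R)"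
      using K by (rule measurable_emeasure_kernel) simp
  qed
  \<comment> \<open>The preimage of \<open>?S\<close> under \<open>Pair x\<close> is the set of
    correct answers to \<open>x\<close>.\<close>
  also have "\<dots> = (\<integral>\<^sup>+x. \<integral>\<^sup>+\<epsilon>. emeasure (answers \<epsilon> x) {a. correct x a} \<partial>?R \<partial>measure_pmf ?Q)"
    by (simp add: vimage_def)
  \<comment> \<open>Almost every question is promised, and on those the inner integral does not
    depend on \<open>x\<close>.\<close>
  also have "\<dots> = (\<integral>\<^sup>+x. ennreal (1 / (2 * \<delta>) * (\<delta> + sin \<delta>)) \<partial>measure_pmf ?Q)"
    using assms Q
    by (intro nn_integral_cong_AE AE_pmfI) (simp add: nn_integral_success)
  also have "\<dots> = ennreal (1 / (2 * \<delta>) * (\<delta> + sin \<delta>))"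
    by simp
  finally have "emeasure (noisy_game \<delta>) ?S = ennreal (1 / (2 * \<delta>) * (\<delta> + sin \<delta>))" .
  moreover have "0 \<le> \<delta> + sin \<delta>"
    using assms by (simp add: add_sin_nonneg)
  ultimately show ?thesis
    using assms by (simp add: average_success_prob_def measure_def)
qed

theorem theorem4:
  fixes \<delta> :: real
  assumes "\<delta> > 0"
  shows "(\<forall>x1 x2 x3. (x1, x2, x3) \<in> promise \<longrightarrow>
           success_prob \<delta> (x1, x2, x3) =
             1 / (2 * \<delta>) * (\<delta> + (sin (pi / 4 + \<delta> / 2))\<^sup>2 - (sin (pi / 4 - \<delta> / 2))\<^sup>2)) \<and>
         average_success_prob \<delta> =
           1 / (2 * \<delta>) * (\<delta> + (sin (pi / 4 + \<delta> / 2))\<^sup>2 - (sin (pi / 4 - \<delta> / 2))\<^sup>2)"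
proof -
  have "\<delta> + (sin (pi / 4 + \<delta> / 2))\<^sup>2 - (sin (pi / 4 - \<delta> / 2))\<^sup>2 = \<delta> + sin \<delta>"
    using sin_square_pi4_diff[of \<delta>] by linarith
  then show ?thesis
    unfolding average_success_prob_eq[OF assms] using success_prob_promise[OF assms] by metis
qed

end
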